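(* Let $Y$ be a finite simple undirected graph with vertex set $\{1,\dots,n\}$ and let $\mathfrak{F}_Y=(F_1,\dots,F_n)$ be a $\pi$-independent list of $Y$-local functions on $\mathbb{F}_2^n$ (so there are only two possible vertex states). Then for each $i$ the restriction $F_i^*$ of $F_i$ to the periodic states $\mathsf{Per}(\mathfrak{F}_Y)$ is either the identity or an involution. As a consequence, the dynamics group $\mathsf{DG}(\mathfrak{F}_Y)$ is either trivial or a quotient of a Coxeter group.
   Context: Here $\mathbb{F}_2=\{0,1\}$. A function $F\colon\mathbb{F}_2^n\to\mathbb{F}_2^n$ is $Y$-local at $i$ if $F(\mathbf{y})$ differs from $\mathbf{y}$ at most in the $i$-th coordinate, and the new value of the $i$-th coordinate depends only on the coordinates of $\mathbf{y}$ indexed by $i$ and its neighbors in $Y$. In $\mathfrak{F}_Y=(F_1,\dots,F_n)$ each $F_i$ is $Y$-local at $i$. An update order is a finite sequence $\omega=(\omega_1,\dots,\omega_m)$ of elements of $\{1,\dots,n\}$; it is simple if each element occurs exactly once. The associated map is $[\mathfrak{F}_Y,\omega]=F_{\omega_m}\circ\cdots\circ F_{\omega_1}$. $\mathsf{Per}[\mathfrak{F}_Y,\omega]$ is the set of states periodic under iteration of $[\mathfrak{F}_Y,\omega]$. $\mathfrak{F}_Y$ is $\pi$-independent if $\mathsf{Per}[\mathfrak{F}_Y,\pi]=\mathsf{Per}[\mathfrak{F}_Y,\pi']$ for all simple update orders $\pi,\pi'$; the common set is denoted $\mathsf{Per}(\mathfrak{F}_Y)$. When $\mathfrak{F}_Y$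 is $\pi$-independent, each $F_i$ restricts to a permutation $F_i^*$ of $\mathsf{Per}(\mathfrak{F}_Y)$, and the dynamics group $\mathsf{DG}(\mathfrak{F}_Y)$ is the group of permutations of $\mathsf{Per}(\mathfrak{F}_Y)$ generated by the restrictions of all $[\mathfrak{F}_Y,\omega]$, $\omega$ any update order (equivalently, generated by $F_1^*,\dots,F_n^*$). A Coxeter group is a group $W$ generated by a finite set of involutions $s_1,\dots,s_r$, with presentation $\langle s_1,\dots,s_r\mid (s_is_j)^{m_{ij}}=1\rangle$, where $m_{ij}\in\mathbb{N}\cup\{\infty\}$ is the order of $s_is_j$ (no relation if $m_{ij}=\infty$). *)

theory Defs
  imports
    "HOL-Algebra.Algebra"
    "HOL-Library.Z2"
    "Graph_Theory.Pair_Digraph"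
begin

(* A finite simple undirected graph is a pair_graph: a finite vertex set with a symmetric,
   irreflexive set of ordered pairs as its arcs. *)

definition nbrs :: "nat pair_pre_digraph \<Rightarrow> nat \<Rightarrow> nat set" where
  "nbrs Y i = {j. (i, j) \<in> parcs Y}"

type_synonym state = "nat \<Rightarrow> bit"

(* F_2^n: every element is undefined outside {1..n}, so that equality of states is equality
   of the coordinates 1, ..., n. *)
definition states :: "nat \<Rightarrow> state set" where
  "states n = {1..n} \<rightarrow>\<^sub>E UNIV"

definition local_at :: "nat pair_pre_digraph \<Rightarrow> nat \<Rightarrow> nat \<Rightarrow> (state \<Rightarrow> state) \<Rightarrow> bool" where
  "local_at Y n i f \<longleftrightarrow>
     f \<in> states n \<rightarrow> states n \<and>
     (\<forall>y\<in>states n. \<forall>j\<in>{1..n}. j \<noteq> i \<longrightarrow> f y j = y j) \<and>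
     (\<forall>y\<in>states n. \<forall>z\<in>states n. (\<forall>j\<in>insert i (nbrs Y i). y j = z j) \<longrightarrow> f y i = f z i)"

definition update_order :: "nat \<Rightarrow> nat list \<Rightarrow> bool" where
  "update_order n \<omega> \<longleftrightarrow> set \<omega> \<subseteq> {1..n}"

definition simple_order :: "nat \<Rightarrow> nat list \<Rightarrow> bool" where
  "simple_order n \<pi> \<longleftrightarrow> set \<pi> = {1..n} \<and> distinct \<pi>"

(* fold F [w1, ..., wm] = F wm o ... o F w1 *)
definition sds_map :: "(nat \<Rightarrow> state \<Rightarrow> state) \<Rightarrow> nat list \<Rightarrow> state \<Rightarrow> state" where
  "sds_map F \<omega> = fold F \<omega>"

definition periodic_states :: "nat \<Rightarrow> (state \<Rightarrow> state) \<Rightarrow> state set" where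
  "periodic_states n f = {y \<in> states n. \<exists>k\<ge>1. (f ^^ k) y = y}"

definition pi_independent :: "nat \<Rightarrow> (nat \<Rightarrow> state \<Rightarrow> state) \<Rightarrow> bool" where
  "pi_independent n F \<longleftrightarrow>
     (\<forall>\<pi> \<pi>'. simple_order n \<pi> \<longrightarrow> simple_order n \<pi>' \<longrightarrow>
        periodic_states n (sds_map F \<pi>) = periodic_states n (sds_map F \<pi>'))"

(* Intended for pi_independent F only, where the order (1, ..., n) can be replaced by any other
   simple order. *)
definition Per :: "nat \<Rightarrow> (nat \<Rightarrow> state \<Rightarrow> state) \<Rightarrow> state set" where
  "Per n F = periodic_states n (sds_map F [1..<Suc n])"

definition Fstar :: "nat \<Rightarrow> (nat \<Rightarrow> state \<Rightarrow> state) \<Rightarrow> nat \<Rightarrow> state \<Rightarrow> state" where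
  "Fstar n F i = restrict (F i) (Per n F)"

definition DG :: "nat \<Rightarrow> (nat \<Rightarrow> state \<Rightarrow> state) \<Rightarrow> (state \<Rightarrow> state) monoid" where
  "DG n F = (BijGroup (Per n F))
     \<lparr>carrier := generate (BijGroup (Per n F))
                  {restrict (sds_map F \<omega>) (Per n F) | \<omega>. update_order n \<omega>}\<rparr>"

definition involution :: "('a, 'b) monoid_scheme \<Rightarrow> 'a \<Rightarrow> bool" where
  "involution G x \<longleftrightarrow> x \<in> carrier G \<and> x \<noteq> \<one>\<^bsub>G\<^esub> \<and> x \<otimes>\<^bsub>G\<^esub> x = \<one>\<^bsub>G\<^esub>"

(* Group words over an index set 'i: (True, i) is the generator i and (False, i) its
   formal inverse. *)
type_synonym 'i gword = "(bool \<times> 'i) list"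

primrec eval_gword :: "('a, 'b) monoid_scheme \<Rightarrow> ('i \<Rightarrow> 'a) \<Rightarrow> 'i gword \<Rightarrow> 'a" where
  "eval_gword G s [] = \<one>\<^bsub>G\<^esub>"
| "eval_gword G s (x # w) =
     (if fst x then s (snd x) else inv\<^bsub>G\<^esub> s (snd x)) \<otimes>\<^bsub>G\<^esub> eval_gword G s w"

(* Equality of words over I in the group given by the generators I and relators R, that is, in
   the quotient of the free group on I by the normal closure of R. *)
inductive gword_eq :: "'i set \<Rightarrow> 'i gword set \<Rightarrow> 'i gword \<Rightarrow> 'i gword \<Rightarrow> bool"
  for I :: "'i set" and R :: "'i gword set" where
  refl: "w \<in> lists (UNIV \<times> I) \<Longrightarrow> gword_eq I R w w"
| sym: "gword_eq I R v w \<Longrightarrow> gword_eq I R w v"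
| trans: "gword_eq I R u v \<Longrightarrow> gword_eq I R v w \<Longrightarrow> gword_eq I R u w"
| cancel: "u \<in> lists (UNIV \<times> I) \<Longrightarrow> v \<in> lists (UNIV \<times> I) \<Longrightarrow> i \<in> I \<Longrightarrow>
     gword_eq I R (u @ [(b, i), (\<not> b, i)] @ v) (u @ v)"
| relator: "u \<in> lists (UNIV \<times> I) \<Longrightarrow> v \<in> lists (UNIV \<times> I) \<Longrightarrow> r \<in> R \<Longrightarrow>
     r \<in> lists (UNIV \<times> I) \<Longrightarrow> gword_eq I R (u @ r @ v) (u @ v)"

(* The canonical map from the free group on I to G is onto, and its kernel is the normal closure
   of R: G = < s i (i in I) | r = 1 (r in R) >. *)
definition has_presentation ::
  "('a, 'b) monoid_scheme \<Rightarrow> 'i set \<Rightarrow> ('i \<Rightarrow> 'a) \<Rightarrow> 'i gword set \<Rightarrow> bool" where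
  "has_presentation G I s R \<longleftrightarrow>
     group G \<and> s ` I \<subseteq> carrier G \<and> generate G (s ` I) = carrier G \<and>
     (\<forall>w\<in>lists (UNIV \<times> I). eval_gword G s w = \<one>\<^bsub>G\<^esub> \<longleftrightarrow> gword_eq I R w [])"

(* group.ord is 0 for elements of infinite order; the relator is then the empty word, so that
   m i j = infinity imposes no relation. *)
definition coxeter_relators :: "('a, 'b) monoid_scheme \<Rightarrow> nat \<Rightarrow> (nat \<Rightarrow> 'a) \<Rightarrow> nat gword set" where
  "coxeter_relators W r s =
     {concat (replicate (group.ord W (s i \<otimes>\<^bsub>W\<^esub> s j)) [(True, i), (True, j)]) | i j.
        i \<in> {1..r} \<and> j \<in> {1..r}}"

definition coxeter_group :: "('a, 'b) monoid_scheme \<Rightarrow> bool" where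
  "coxeter_group W \<longleftrightarrow>
     group W \<and>
     (\<exists>r s. inj_on s {1..r} \<and> (\<forall>i\<in>{1..r}. involution W (s i)) \<and>
            has_presentation W {1..r} s (coxeter_relators W r s))"

(* HOL cannot quantify over the type of the elements of W. Fixing it loses nothing: a Coxeter
   group is isomorphic to one whose elements are classes of words in its generators 1, ..., r. *)
definition quotient_of_coxeter_group :: "('a, 'b) monoid_scheme \<Rightarrow> bool" where
  "quotient_of_coxeter_group G \<longleftrightarrow>
     (\<exists>(W :: nat gword set monoid) N. coxeter_group W \<and> N \<lhd> W \<and> W Mod N \<cong> G)"

end

theory Submission
  imports Defs
begin

text \<open>
  Fix a vertex \<open>i\<close>, and let \<open>G\<close> be the composite of the local functions
  of the other vertices in some order. Updating \<open>i\<close> first gives the map \<open>G \<circ> F\<^sub>i\<close>, updating it last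
  gives \<open>F\<^sub>i \<circ> G\<close>. The function \<open>F\<^sub>i\<close> carries the periodic states of the former to periodic states of
  the latter, and \<open>\<pi>\<close>-independence says that these are the same finite set. A map is injective on
  its own periodic states, so \<open>F\<^sub>i\<close> is injective there as well, hence it permutes them
  (\<open>bij_betw_Per\<close>). If \<open>F\<^sub>i\<close> moves a periodic state \<open>y\<close>, it flips the \<open>i\<close>-th bit. By injectivity
  the result cannot be a fixed point of \<open>F\<^sub>i\<close>, so the second application flips the same bit again
  and returns to \<open>y\<close> (\<open>local_at_involutive\<close>). This is where it matters that a vertex has only two
  states.

  The dynamics group is therefore generated by a finite set of involutions \<open>t\<^sub>1, \<dots>, t\<^sub>r\<close>, namely the
  nontrivial restrictions (\<open>DG_eq_generate\<close>). Every such group \<open>D\<close> is a quotient of a Coxeter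
  group (\<open>quotient_of_coxeter_group_if_generated_by_involutions\<close>). Let \<open>m\<^sub>i\<^sub>j\<close> be the order of
  \<open>t\<^sub>i t\<^sub>j\<close> in \<open>D\<close>, and let \<open>W\<close> be the group presented by generators \<open>s\<^sub>1, \<dots>, s\<^sub>r\<close> and relators
  \<open>(s\<^sub>i s\<^sub>j)\<close> to the power \<open>m\<^sub>i\<^sub>j\<close>. Usually the hard part is to see that \<open>s\<^sub>i s\<^sub>j\<close> has no smaller order than
  \<open>m\<^sub>i\<^sub>j\<close>, for which one needs the geometric representation. Here the homomorphism from \<open>W\<close> onto \<open>D\<close>
  that sends \<open>s\<^sub>i\<close> to \<open>t\<^sub>i\<close> settles the matter, because the image of \<open>s\<^sub>i s\<^sub>j\<close> already has order \<open>m\<^sub>i\<^sub>j\<close>.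
\<close>

section \<open>Groups given by generators and relators\<close>

definition gword_class :: "'i set \<Rightarrow> 'i gword set \<Rightarrow> 'i gword \<Rightarrow> 'i gword set" where
  "gword_class I R w = {v. gword_eq I R w v}"

text \<open>
  Multiplication picks representatives, so that it is a total function on sets of words;
  \<open>presented_group_mult\<close> shows that the choice has no effect on classes.
\<close>

definition presented_group :: "'i set \<Rightarrow> 'i gword set \<Rightarrow> 'i gword set monoid" where
  "presented_group I R =
     \<lparr>carrier = gword_class I R ` lists (UNIV \<times> I),
      monoid.mult = (\<lambda>A B. gword_class I R ((SOME u. u \<in> A) @ (SOME v. v \<in> B))),
      one = gword_class I R []\<rparr>"

definition gword_inverse :: "'i gword \<Rightarrow> 'i gword" where
  "gword_inverse w = rev (map (\<lambda>(b, i). (\<not> b, i)) w)"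

lemma gword_eq_lists:
  assumes "gword_eq I R u v"
  shows "u \<in> lists (UNIV \<times> I)" "v \<in> lists (UNIV \<times> I)"
  using assms by (induction rule: gword_eq.induct) auto

text \<open>
  The relations are closed under surrounding words because the generating steps (cancellation and
  removal of a relator) are allowed at any position. This makes concatenation well defined on
  classes.
\<close>

lemma gword_eq_context:
  assumes "gword_eq I R u v" and x: "x \<in> lists (UNIV \<times> I)" and y: "y \<in> lists (UNIV \<times> I)"
  shows "gword_eq I R (x @ u @ y) (x @ v @ y)"
  using assms(1)
proof (induction rule: gword_eq.induct)
  case (refl w)
  then show ?case using x y by (intro gword_eq.refl) auto
next
  case (sym v w)
  then show ?case by (blast intro: gword_eq.sym)
next
  case (trans u v w)
  then show ?case by (blast intro: gword_eq.trans)
next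
  case (cancel u v i b)
  then show ?case using gword_eq.cancel[of "x @ u" I "v @ y" i R b] x y by simp
next
  case (relator u v r)
  then show ?case using gword_eq.relator[of "x @ u" I "v @ y" r R] x y by simp
qed

lemma gword_eq_append:
  assumes "gword_eq I R u u'" "gword_eq I R v v'"
  shows "gword_eq I R (u @ v) (u' @ v')"
  using gword_eq_context[OF assms(1), of "[]" v] gword_eq_context[OF assms(2), of u' "[]"]
    gword_eq_lists[OF assms(1)] gword_eq_lists[OF assms(2)]
  by (auto intro: gword_eq.trans)

lemma gword_inverse_lists:
  "w \<in> lists (UNIV \<times> I) \<Longrightarrow> gword_inverse w \<in> lists (UNIV \<times> I)"
  by (auto simp: gword_inverse_def)

lemma gword_inverse_append:
  assumes "w \<in> lists (UNIV \<times> I)"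
  shows "gword_eq I R (gword_inverse w @ w) []"
  using assms
proof (induction w)
  case Nil
  then show ?case by (simp add: gword_inverse_def gword_eq.refl)
next
  case (Cons x w)
  obtain b i where x: "x = (b, i)" by (cases x)
  have "gword_eq I R (gword_inverse w @ [(\<not> b, i), (\<not> \<not> b, i)] @ w) (gword_inverse w @ w)"
    using Cons.hyps x gword_inverse_lists[of w I] by (intro gword_eq.cancel) auto
  moreover have "gword_inverse (x # w) @ x # w = gword_inverse w @ [(\<not> b, i), (\<not> \<not> b, i)] @ w"
    by (simp add: gword_inverse_def x)
  ultimately show ?case
    using Cons by (auto intro: gword_eq.trans)
qed

lemma gword_class_eq_iff:
  assumes "u \<in> lists (UNIV \<times> I)"
  shows "gword_class I R u = gword_class I R v \<longleftrightarrow> gword_eq I R u v"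
proof
  assume "gword_class I R u = gword_class I R v"
  moreover have "u \<in> gword_class I R u"
    using assms by (simp add: gword_class_def gword_eq.refl)
  ultimately show "gword_eq I R u v"
    by (simp add: gword_class_def gword_eq.sym)
next
  assume "gword_eq I R u v"
  then show "gword_class I R u = gword_class I R v"
    unfolding gword_class_def by (blast intro: gword_eq.sym gword_eq.trans)
qed

lemma some_in_gword_class:
  assumes "u \<in> lists (UNIV \<times> I)"
  shows "gword_eq I R u (SOME v. v \<in> gword_class I R u)"
  using someI[of "\<lambda>v. v \<in> gword_class I R u" u] assms
  by (simp add: gword_class_def gword_eq.refl)

lemma presented_group_mult:
  assumes "u \<in> lists (UNIV \<times> I)" "v \<in> lists (UNIV \<times> I)"
  shows "gword_class I R u \<otimes>\<^bsub>presented_group I R\<^esub> gword_class I R v = gword_class I R (u @ v)"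
proof -
  have "gword_eq I R (u @ v)
          ((SOME w. w \<in> gword_class I R u) @ (SOME w. w \<in> gword_class I R v))"
    using assms by (intro gword_eq_append some_in_gword_class)
  moreover have "u @ v \<in> lists (UNIV \<times> I)" using assms by simp
  ultimately have "gword_class I R (u @ v) = gword_class I R
      ((SOME w. w \<in> gword_class I R u) @ (SOME w. w \<in> gword_class I R v))"
    by (simp only: gword_class_eq_iff)
  then show ?thesis by (simp add: presented_group_def)
qed

lemma group_presented_group: "group (presented_group I R)"
proof (rule groupI)
  show "\<one>\<^bsub>presented_group I R\<^esub> \<in> carrier (presented_group I R)"
    by (auto simp: presented_group_def)
next
  fix A B assume "A \<in> carrier (presented_group I R)" "B \<in> carrier (presented_group I R)"
  then obtain u v where "u \<in> lists (UNIV \<times> I)" "v \<in> lists (UNIV \<times> I)"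
      "A = gword_class I R u" "B = gword_class I R v"
    by (auto simp: presented_group_def)
  then show "A \<otimes>\<^bsub>presented_group I R\<^esub> B \<in> carrier (presented_group I R)"
    by (simp add: presented_group_mult) (simp add: presented_group_def)
next
  fix A B C assume "A \<in> carrier (presented_group I R)" "B \<in> carrier (presented_group I R)"
    "C \<in> carrier (presented_group I R)"
  then obtain u v w where "u \<in> lists (UNIV \<times> I)" "v \<in> lists (UNIV \<times> I)" "w \<in> lists (UNIV \<times> I)"
      "A = gword_class I R u" "B = gword_class I R v" "C = gword_class I R w"
    by (auto simp: presented_group_def)
  then show "A \<otimes>\<^bsub>presented_group I R\<^esub> B \<otimes>\<^bsub>presented_group I R\<^esub> C =
      A \<otimes>\<^bsub>presented_group I R\<^esub> (B \<otimes>\<^bsub>presented_group I R\<^esub> C)"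
    by (simp add: presented_group_mult)
next
  fix A assume "A \<in> carrier (presented_group I R)"
  then obtain u where u: "u \<in> lists (UNIV \<times> I)" "A = gword_class I R u"
    by (auto simp: presented_group_def)
  have one: "\<one>\<^bsub>presented_group I R\<^esub> = gword_class I R []"
    by (simp add: presented_group_def)
  show "\<one>\<^bsub>presented_group I R\<^esub> \<otimes>\<^bsub>presented_group I R\<^esub> A = A"
    using u by (simp add: one presented_group_mult)
  have "gword_class I R (gword_inverse u) \<otimes>\<^bsub>presented_group I R\<^esub> A = \<one>\<^bsub>presented_group I R\<^esub>"
    using u gword_inverse_append[OF u(1), of R] gword_inverse_lists[OF u(1)]
    by (simp add: one presented_group_mult gword_class_eq_iff)
  moreover have "gword_class I R (gword_inverse u) \<in> carrier (presented_group I R)"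
    using gword_inverse_lists[OF u(1)] by (simp add: presented_group_def)
  ultimately show "\<exists>B\<in>carrier (presented_group I R).
      B \<otimes>\<^bsub>presented_group I R\<^esub> A = \<one>\<^bsub>presented_group I R\<^esub>"
    by blast
qed

definition presented_gen :: "'i set \<Rightarrow> 'i gword set \<Rightarrow> 'i \<Rightarrow> 'i gword set" where
  "presented_gen I R i = gword_class I R [(True, i)]"

lemma presented_gen_closed:
  "i \<in> I \<Longrightarrow> presented_gen I R i \<in> carrier (presented_group I R)"
  by (auto simp: presented_gen_def presented_group_def)

lemma inv_presented_gen:
  assumes "i \<in> I"
  shows "inv\<^bsub>presented_group I R\<^esub> presented_gen I R i = gword_class I R [(False, i)]"
proof (rule group.inv_equality[OF group_presented_group])
  show "gword_class I R [(False, i)] \<otimes>\<^bsub>presented_group I R\<^esub> presented_gen I R i =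
      \<one>\<^bsub>presented_group I R\<^esub>"
    using assms gword_eq.cancel[of "[]" I "[]" i R False]
    by (simp add: presented_gen_def presented_group_mult)
      (simp add: presented_group_def gword_class_eq_iff)
qed (use assms in \<open>auto simp: presented_gen_def presented_group_def\<close>)

text \<open>
  Evaluating a word at the generators of the presented group amounts to taking its class. Hence
  the words that evaluate to the identity are exactly those that the relators make trivial, which
  is the content of \<open>presented_group_has_presentation\<close>.
\<close>

lemma eval_presented_gen:
  assumes "w \<in> lists (UNIV \<times> I)"
  shows "eval_gword (presented_group I R) (presented_gen I R) w = gword_class I R w"
  using assms
proof (induction w)
  case Nil
  then show ?case by (simp add: presented_group_def)
next
  case (Cons x w)
  have "snd x \<in> I" using Cons.hyps by auto
  then have "(if fst x then presented_gen I R (snd x)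
      else inv\<^bsub>presented_group I R\<^esub> presented_gen I R (snd x)) = gword_class I R [x]"
    by (cases x) (simp add: inv_presented_gen, simp add: presented_gen_def)
  then show ?case
    using Cons presented_group_mult[of "[x]" I w R] by simp
qed

lemma (in group) eval_gword_closed:
  assumes "s ` I \<subseteq> carrier G" "w \<in> lists (UNIV \<times> I)"
  shows "eval_gword G s w \<in> carrier G"
  using assms(2) by (induction w) (use assms(1) in auto)

lemma (in group) eval_gword_append:
  assumes s: "s ` I \<subseteq> carrier G" and "u \<in> lists (UNIV \<times> I)" and v: "v \<in> lists (UNIV \<times> I)"
  shows "eval_gword G s (u @ v) = eval_gword G s u \<otimes> eval_gword G s v"
  using assms(2)
proof (induction u)
  case Nil
  then show ?case using eval_gword_closed[OF s v] by simp
next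
  case (Cons x u)
  have "(if fst x then s (snd x) else inv s (snd x)) \<in> carrier G"
    using Cons.hyps s by auto
  then show ?case
    using Cons eval_gword_closed[OF s v] eval_gword_closed[OF s, of u] by (simp add: m_assoc)
qed

lemma (in group) eval_gword_in_generate:
  assumes s: "s ` I \<subseteq> carrier G" and "w \<in> lists (UNIV \<times> I)"
  shows "eval_gword G s w \<in> generate G (s ` I)"
  using assms(2)
proof (induction w)
  case Nil
  then show ?case by (simp add: generate.one)
next
  case (Cons x w)
  have "(if fst x then s (snd x) else inv s (snd x)) \<in> generate G (s ` I)"
    using Cons.hyps by (auto intro: generate.incl generate.inv)
  then show ?case using Cons by (simp add: generate.eng)
qed

lemma presented_group_has_presentation:
  "has_presentation (presented_group I R) I (presented_gen I R) R"
proof -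
  let ?W = "presented_group I R"
  have sub: "presented_gen I R ` I \<subseteq> carrier ?W"
    by (intro image_subsetI presented_gen_closed)
  have "carrier ?W \<subseteq> generate ?W (presented_gen I R ` I)"
  proof
    fix A assume "A \<in> carrier ?W"
    then obtain w where w: "w \<in> lists (UNIV \<times> I)" "A = gword_class I R w"
      by (auto simp: presented_group_def)
    show "A \<in> generate ?W (presented_gen I R ` I)"
      using group.eval_gword_in_generate[OF group_presented_group sub w(1)] w
      by (simp add: eval_presented_gen)
  qed
  moreover have "generate ?W (presented_gen I R ` I) \<subseteq> carrier ?W"
    using group.generate_incl[OF group_presented_group sub] .
  moreover have "eval_gword ?W (presented_gen I R) w = \<one>\<^bsub>?W\<^esub> \<longleftrightarrow> gword_eq I R w []"
    if "w \<in> lists (UNIV \<times> I)" for w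
    using that gword_class_eq_iff[OF that, of R "[]"]
    by (simp add: eval_presented_gen) (simp add: presented_group_def)
  ultimately show ?thesis
    using sub unfolding has_presentation_def
    by (intro conjI group_presented_group equalityI ballI)
qed

lemma (in group) eval_gword_respects_gword_eq:
  assumes s: "s ` I \<subseteq> carrier G"
    and R: "\<And>r. r \<in> R \<Longrightarrow> r \<in> lists (UNIV \<times> I) \<Longrightarrow> eval_gword G s r = \<one>"
    and "gword_eq I R u v"
  shows "eval_gword G s u = eval_gword G s v"
  using assms(3)
proof (induction rule: gword_eq.induct)
  case (cancel u v i b)
  have "s i \<in> carrier G" using s cancel by auto
  then have "eval_gword G s ([(b, i), (\<not> b, i)] @ v) = eval_gword G s v"
    using eval_gword_closed[OF s cancel(2)] by (simp add: m_assoc[symmetric])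
  then show ?case
    using cancel eval_gword_append[OF s, of u "[(b, i), (\<not> b, i)] @ v"]
      eval_gword_append[OF s, of u v]
    by auto
next
  case (relator u v r)
  have "eval_gword G s (r @ v) = eval_gword G s v"
    using R[OF relator(3,4)] relator eval_gword_append[OF s, of r v] eval_gword_closed[OF s, of v]
    by simp
  then show ?case
    using relator eval_gword_append[OF s, of u "r @ v"] eval_gword_append[OF s, of u v] by simp
qed auto

text \<open>
  Von Dyck's theorem: evaluation at elements that satisfy the relators is constant on classes, and
  so it descends to a homomorphism.
\<close>

lemma (in group) presented_group_universal:
  assumes s: "s ` I \<subseteq> carrier G"
    and R: "\<And>r. r \<in> R \<Longrightarrow> r \<in> lists (UNIV \<times> I) \<Longrightarrow> eval_gword G s r = \<one>"
  shows "\<exists>h \<in> hom (presented_group I R) G.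
    \<forall>w \<in> lists (UNIV \<times> I). h (gword_class I R w) = eval_gword G s w"
proof -
  define h where "h A = eval_gword G s (SOME w. w \<in> A)" for A
  have h: "h (gword_class I R w) = eval_gword G s w" if "w \<in> lists (UNIV \<times> I)" for w
    unfolding h_def
    by (rule eval_gword_respects_gword_eq[OF s R some_in_gword_class[OF that], symmetric])
  moreover have "h \<in> hom (presented_group I R) G"
  proof (rule homI)
    fix A assume "A \<in> carrier (presented_group I R)"
    then obtain u where "u \<in> lists (UNIV \<times> I)" "A = gword_class I R u"
      by (auto simp: presented_group_def)
    then show "h A \<in> carrier G" using h eval_gword_closed[OF s] by simp
  next
    fix A B assume "A \<in> carrier (presented_group I R)" "B \<in> carrier (presented_group I R)"
    then obtain u v where "u \<in> lists (UNIV \<times> I)" "v \<in> lists (UNIV \<times> I)"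
        "A = gword_class I R u" "B = gword_class I R v"
      by (auto simp: presented_group_def)
    then show "h (A \<otimes>\<^bsub>presented_group I R\<^esub> B) = h A \<otimes> h B"
      using h eval_gword_append[OF s] by (simp add: presented_group_mult)
  qed
  ultimately show ?thesis by (intro bexI[of _ h] ballI)
qed

section \<open>Groups generated by involutions\<close>

lemma (in group) eval_gword_power:
  assumes s: "s ` I \<subseteq> carrier G" and "i \<in> I" "j \<in> I"
  shows "eval_gword G s (concat (replicate k [(True, i), (True, j)])) = (s i \<otimes> s j) [^] k"
proof (induction k)
  case (Suc k)
  have "s i \<in> carrier G" "s j \<in> carrier G" using assms by auto
  then have "(s i \<otimes> s j) [^] Suc k = (s i \<otimes> s j) \<otimes> (s i \<otimes> s j) [^] k"
    by (intro nat_pow_Suc2) simp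
  then show ?case using Suc \<open>s i \<in> carrier G\<close> \<open>s j \<in> carrier G\<close> by (simp add: m_assoc)
qed simp

text \<open>
  The relators are read off from the orders of the products \<open>t i \<otimes> t j\<close> in \<open>G\<close> itself. The relators
  bound the orders of the corresponding products in \<open>W\<close> from above (in the sense of divisibility),
  and the homomorphism onto \<open>G\<close> bounds them from below. So the relators are also the ones that the
  orders in \<open>W\<close> prescribe. Divisibility also covers infinite order, which is represented by \<open>0\<close>.
  The same homomorphism shows that the generators of \<open>W\<close> are distinct and nontrivial.
\<close>

lemma (in group) quotient_of_coxeter_group_if_generated_by_involutions:
  assumes "finite T" and T: "\<And>t. t \<in> T \<Longrightarrow> involution G t" and gen: "generate G T = carrier G"
  shows "quotient_of_coxeter_group G"
proof -
  define r where "r = card T"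
  obtain t where t: "bij_betw t {1..r} T"
    unfolding r_def using ex_bij_betw_nat_finite_1[OF assms(1)] ..
  define I where "I = {1..r}"
  define R where "R = coxeter_relators G r t"
  define W where "W = presented_group I R"
  define s where "s = presented_gen I R"
  have inv_t: "involution G (t i)" if "i \<in> I" for i
    using T t that by (auto simp: bij_betw_def I_def)
  have tI: "t ` I = T" and inj_t: "inj_on t I"
    using t by (auto simp: bij_betw_def I_def)
  have tG: "t ` I \<subseteq> carrier G" using inv_t by (auto simp: involution_def)
  have R1: "eval_gword G t q = \<one>" if q_R: "q \<in> R" for q
  proof -
    obtain i j where ij: "i \<in> I" "j \<in> I"
      and q: "q = concat (replicate (ord (t i \<otimes> t j)) [(True, i), (True, j)])"
      using q_R unfolding R_def coxeter_relators_def I_def by blast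
    have "t i \<otimes> t j \<in> carrier G" using tG ij by auto
    then show ?thesis using eval_gword_power[OF tG ij] q by simp
  qed
  have "\<exists>h \<in> hom W G. \<forall>w \<in> lists (UNIV \<times> I). h (gword_class I R w) = eval_gword G t w"
    unfolding W_def by (rule presented_group_universal[OF tG R1])
  then obtain h where h: "h \<in> hom W G"
    and h_class: "\<forall>w \<in> lists (UNIV \<times> I). h (gword_class I R w) = eval_gword G t w"
    by (elim bexE)
  interpret W: group W unfolding W_def by (rule group_presented_group)
  interpret h: group_hom W G h by unfold_locales (rule h)
  have sW: "s i \<in> carrier W" if "i \<in> I" for i
    using that presented_gen_closed by (simp add: s_def W_def)
  have sWI: "s ` I \<subseteq> carrier W" using sW by blast
  have hs: "h (s i) = t i" if "i \<in> I" for i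
  proof -
    have "t i \<in> carrier G" using that tG by auto
    then show ?thesis using that bspec[OF h_class, of "[(True, i)]"] by (simp add: s_def presented_gen_def)
  qed
  have pres: "has_presentation W I s R"
    unfolding W_def s_def by (rule presented_group_has_presentation)
  have ord_eq: "W.ord (s i \<otimes>\<^bsub>W\<^esub> s j) = ord (t i \<otimes> t j)" if ij: "i \<in> I" "j \<in> I" for i j
  proof (rule dvd_antisym)
    let ?q = "concat (replicate (ord (t i \<otimes> t j)) [(True, i), (True, j)])"
    have "?q \<in> lists (UNIV \<times> I)" using ij by (auto split: if_splits)
    moreover have "?q \<in> R" using ij unfolding R_def coxeter_relators_def I_def by blast
    ultimately have "gword_eq I R ?q []"
      using gword_eq.relator[of "[]" I "[]" ?q R] by simp
    then have "eval_gword W s ?q = \<one>\<^bsub>W\<^esub>"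
      using pres \<open>?q \<in> lists (UNIV \<times> I)\<close> by (simp add: has_presentation_def)
    then have "(s i \<otimes>\<^bsub>W\<^esub> s j) [^]\<^bsub>W\<^esub> ord (t i \<otimes> t j) = \<one>\<^bsub>W\<^esub>"
      using W.eval_gword_power[OF sWI ij] by simp
    then show "W.ord (s i \<otimes>\<^bsub>W\<^esub> s j) dvd ord (t i \<otimes> t j)"
      using W.pow_eq_id sW ij by simp
  next
    have x: "s i \<otimes>\<^bsub>W\<^esub> s j \<in> carrier W" using sW ij by simp
    have "h (s i \<otimes>\<^bsub>W\<^esub> s j) [^] W.ord (s i \<otimes>\<^bsub>W\<^esub> s j)
        = h ((s i \<otimes>\<^bsub>W\<^esub> s j) [^]\<^bsub>W\<^esub> W.ord (s i \<otimes>\<^bsub>W\<^esub> s j))"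
      using h.hom_nat_pow[OF x] by simp
    also have "\<dots> = \<one>" using x by simp
    finally have "(t i \<otimes> t j) [^] W.ord (s i \<otimes>\<^bsub>W\<^esub> s j) = \<one>"
      using hs ij sW by simp
    moreover have "t i \<otimes> t j \<in> carrier G" using tG ij by auto
    ultimately show "ord (t i \<otimes> t j) dvd W.ord (s i \<otimes>\<^bsub>W\<^esub> s j)"
      using pow_eq_id by simp
  qed
  have "(w = concat (replicate (W.ord (s i \<otimes>\<^bsub>W\<^esub> s j)) [(True, i), (True, j)]) \<and>
         i \<in> I \<and> j \<in> I) =
      (w = concat (replicate (ord (t i \<otimes> t j)) [(True, i), (True, j)]) \<and> i \<in> I \<and> j \<in> I)"
    for w i j
    using ord_eq[of i j] by (cases "i \<in> I \<and> j \<in> I") auto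
  then have "coxeter_relators W r s = R"
    unfolding R_def coxeter_relators_def I_def by simp
  moreover have "inj_on s I"
  proof (rule inj_onI)
    fix i j assume "i \<in> I" "j \<in> I" "s i = s j"
    then have "t i = t j" using hs[of i] hs[of j] by simp
    then show "i = j" using inj_t \<open>i \<in> I\<close> \<open>j \<in> I\<close> by (simp add: inj_on_def)
  qed
  moreover have "involution W (s i)" if i: "i \<in> I" for i
  proof -
    have "t i \<otimes> t i = \<one>" "t i \<noteq> \<one>" using inv_t[OF i] by (auto simp: involution_def)
    \<comment> \<open>A diagonal relator is the square of a generator, since \<open>t i \<otimes> t i\<close> has order \<open>1\<close>.\<close>
    then have "W.ord (s i \<otimes>\<^bsub>W\<^esub> s i) = 1" using ord_eq[OF i i] by simp
    then have "s i \<otimes>\<^bsub>W\<^esub> s i = \<one>\<^bsub>W\<^esub>" using sW[OF i] W.ord_eq_1 by simp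
    moreover have "s i \<noteq> \<one>\<^bsub>W\<^esub>" using hs[OF i] \<open>t i \<noteq> \<one>\<close> by force
    ultimately show ?thesis using sW[OF i] by (simp add: involution_def)
  qed
  ultimately have "coxeter_group W"
    using pres W.is_group unfolding coxeter_group_def I_def by blast
  moreover have "h ` carrier W = carrier G"
  proof
    show "carrier G \<subseteq> h ` carrier W"
    proof -
      have "t i \<in> h ` carrier W" if "i \<in> I" for i
        using imageI[OF sW[OF that], of h] hs[OF that] by simp
      then have "T \<subseteq> h ` carrier W" using tI by blast
      then show ?thesis
        using generate_subgroup_incl[OF _ h.img_is_subgroup] gen by blast
    qed
  qed auto
  then have "W Mod kernel W G h \<cong> G" by (rule h.FactGroup_iso)
  ultimately show ?thesis
    unfolding quotient_of_coxeter_group_def W_def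
    using h.normal_kernel[unfolded W_def] by blast
qed

section \<open>Local functions on the periodic states\<close>

lemma finite_states: "finite (states n)"
proof -
  have "(UNIV :: bit set) = {0, 1}" by (auto intro: bit.exhaust)
  then have "finite (UNIV :: bit set)" by (metis finite.emptyI finite.insertI)
  then show ?thesis unfolding states_def by (intro finite_PiE) auto
qed

text \<open>
  The map \<open>f\<close> semiconjugates \<open>g \<circ> f\<close> to \<open>f \<circ> g\<close>, so it takes cycles of the first map to cycles of the
  second.
\<close>

lemma periodic_states_swap:
  assumes "f \<in> states n \<rightarrow> states n" "y \<in> periodic_states n (g \<circ> f)"
  shows "f y \<in> periodic_states n (f \<circ> g)"
proof -
  obtain k where k: "k \<ge> 1" "((g \<circ> f) ^^ k) y = y" "y \<in> states n"
    using assms(2) by (auto simp: periodic_states_def)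
  have "((f \<circ> g) ^^ k) (f y) = f (((g \<circ> f) ^^ k) y)"
    by (induction k) auto
  then show ?thesis using k assms(1) by (auto simp: periodic_states_def)
qed

text \<open>
  If \<open>x\<close> and \<open>y\<close> have periods \<open>k\<close> and \<open>l\<close>, then both are recovered from their images under \<open>f\<close> by
  iterating \<open>f\<close> another \<open>l * k - 1\<close> times.
\<close>

lemma inj_on_periodic_states: "inj_on f (periodic_states n f)"
proof (rule inj_onI)
  fix x y assume "x \<in> periodic_states n f" "y \<in> periodic_states n f" and eq: "f x = f y"
  then obtain k l where k: "k \<ge> 1" "(f ^^ k) x = x" and l: "l \<ge> 1" "(f ^^ l) y = y"
    by (auto simp: periodic_states_def)
  have "(f ^^ (m * k)) x = x" for m using k(2) by (induction m) (auto simp: funpow_add)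
  then have x: "(f ^^ (l * k)) x = x" .
  have "(f ^^ (m * l)) y = y" for m using l(2) by (induction m) (auto simp: funpow_add)
  then have y: "(f ^^ (l * k)) y = y" by (metis mult.commute)
  obtain m where "l * k = Suc m" using k l by (cases "l * k") auto
  then show "x = y" using x y eq by (metis comp_apply funpow_Suc_right)
qed

lemma Per_eq:
  assumes "pi_independent n F" "simple_order n \<pi>"
  shows "periodic_states n (sds_map F \<pi>) = Per n F"
proof -
  have "simple_order n [1..<Suc n]" by (auto simp: simple_order_def)
  then show ?thesis using assms unfolding Per_def pi_independent_def by blast
qed

text \<open>
  Comparing the update orders in which \<open>i\<close> comes first and last shows that \<open>F i\<close> maps the periodic
  states to themselves; it is injective there because it is the inner factor of a map that is.
\<close>

lemma bij_betw_Per: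
  assumes F: "\<And>i. i \<in> {1..n} \<Longrightarrow> F i \<in> states n \<rightarrow> states n"
    and ind: "pi_independent n F" and i: "i \<in> {1..n}"
  shows "bij_betw (F i) (Per n F) (Per n F)"
proof -
  define w where "w = filter (\<lambda>j. j \<noteq> i) [1..<Suc n]"
  define g where "g = sds_map F w"
  have "simple_order n (i # w)" "simple_order n (w @ [i])"
    using i by (auto simp: simple_order_def w_def)
  then have P: "Per n F = periodic_states n (g \<circ> F i)" "Per n F = periodic_states n (F i \<circ> g)"
    using Per_eq[OF ind, of "i # w"] Per_eq[OF ind, of "w @ [i]"]
    by (simp_all add: sds_map_def g_def)
  have "F i ` Per n F \<subseteq> Per n F"
    using periodic_states_swap[OF F[OF i], of _ g] P by auto
  moreover have "inj_on (F i) (Per n F)"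
    using inj_on_periodic_states[of "g \<circ> F i" n] P(1) inj_on_imageI2 by metis
  moreover have "finite (Per n F)"
    by (rule finite_subset[OF _ finite_states[of n]]) (auto simp: Per_def periodic_states_def)
  ultimately show ?thesis by (simp add: bij_betw_def endo_inj_surj)
qed

text \<open>
  A bit that changes can only change to its other value. If \<open>f\<close> flips the \<open>i\<close>-th bit of \<open>y\<close>, then
  injectivity prevents \<open>f y\<close> from being fixed, so the bit is flipped back.
\<close>

lemma local_at_involutive:
  assumes loc: "local_at Y n i f" and bij: "bij_betw f P P" and P: "P \<subseteq> states n" and y: "y \<in> P"
  shows "f (f y) = y"
proof (cases "f y = y")
  case False
  have P1: "f y \<in> P" "f (f y) \<in> P" using bij y by (auto simp: bij_betw_def)
  then have st: "y \<in> states n" "f y \<in> states n" "f (f y) \<in> states n" using P y by auto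
  have diff: "f z j = z j" if "z \<in> states n" "j \<noteq> i" for z j
  proof (cases "j \<in> {1..n}")
    case True
    then show ?thesis using loc that by (auto simp: local_at_def)
  next
    case False
    \<comment> \<open>Outside the vertex set all states take the same default value.\<close>
    have "f z \<in> states n" using loc that by (auto simp: local_at_def)
    then have "f z j = undefined" "z j = undefined"
      using that(1) False by (auto simp: states_def PiE_def extensional_def)
    then show ?thesis by simp
  qed
  have differ: "u i \<noteq> v i" if "u \<noteq> v" "\<And>j. j \<noteq> i \<Longrightarrow> u j = v j" for u v :: state
  proof
    assume "u i = v i"
    then have "u j = v j" for j using that(2)[of j] by (cases "j = i") simp_all
    then have "u = v" by (rule ext)
    then show False using that(1) by contradiction
  qed
  have "f (f y) \<noteq> f y" using bij P1 y False by (auto simp: bij_betw_def inj_on_def)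
  then have "f (f y) i \<noteq> f y i" by (rule differ) (rule diff[OF st(2)])
  moreover have "f y i \<noteq> y i" using False by (rule differ) (rule diff[OF st(1)])
  ultimately have "f (f y) i = y i" by (cases "f (f y) i"; cases "f y i"; cases "y i") simp_all
  then have "f (f y) j = y j" for j
    using diff[OF st(1), of j] diff[OF st(2), of j] by (cases "j = i") simp_all
  then show ?thesis by (rule ext)
qed simp

section \<open>The dynamics group\<close>

text \<open>
  The update map of a sequence is the product of the restrictions of its entries, and each
  restriction arises from a sequence of length one. The identity is left out of the generating set
  so that only involutions remain.
\<close>

lemma DG_eq_generate:
  assumes "\<And>i. i \<in> {1..n} \<Longrightarrow> bij_betw (F i) (Per n F) (Per n F)"
  shows "carrier (DG n F) =
    generate (BijGroup (Per n F)) (Fstar n F ` {1..n} - {\<one>\<^bsub>BijGroup (Per n F)\<^esub>})"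
proof -
  define P where "P = Per n F"
  define B where "B = BijGroup P"
  define T where "T = Fstar n F ` {1..n} - {\<one>\<^bsub>B\<^esub>}"
  define S where "S = {restrict (sds_map F \<omega>) P | \<omega>. update_order n \<omega>}"
  interpret B: group B unfolding B_def by (rule group_BijGroup)
  have B_mult: "f \<otimes>\<^bsub>B\<^esub> g = compose P f g" if "f \<in> carrier B" "g \<in> carrier B" for f g
    using that by (simp add: B_def BijGroup_def)
  have Fs: "Fstar n F i \<in> carrier B" if "i \<in> {1..n}" for i
    using assms[OF that] by (simp add: Fstar_def B_def P_def BijGroup_def Bij_def)
  have TB: "T \<subseteq> carrier B" using Fs by (auto simp: T_def)
  have FT: "Fstar n F i \<in> generate B T" if "i \<in> {1..n}" for i
    using that by (cases "Fstar n F i = \<one>\<^bsub>B\<^esub>") (auto simp: T_def intro: generate.incl generate.one)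
  have sub: "subgroup (generate B T) B" by (rule B.generate_is_subgroup[OF TB])
  have "restrict (sds_map F \<omega>) P \<in> generate B T" if "set \<omega> \<subseteq> {1..n}" for \<omega>
    using that
  proof (induction \<omega>)
    case Nil
    have "restrict (sds_map F []) P = \<one>\<^bsub>B\<^esub>"
      by (auto simp: sds_map_def B_def BijGroup_def)
    then show ?case by (simp add: generate.one)
  next
    case (Cons i \<omega>)
    have i: "i \<in> {1..n}" using Cons.prems by simp
    have IH: "restrict (sds_map F \<omega>) P \<in> generate B T"
      by (rule Cons.IH) (use Cons.prems in simp)
    then have rest: "restrict (sds_map F \<omega>) P \<in> carrier B"
      by (rule B.generate_in_carrier[OF TB])
    have "F i x \<in> P" if "x \<in> P" for x
      using assms[OF i] that by (auto simp: bij_betw_def P_def)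
    then have "restrict (sds_map F (i # \<omega>)) P x =
        compose P (restrict (sds_map F \<omega>) P) (Fstar n F i) x" for x
      by (cases "x \<in> P") (simp_all add: compose_def Fstar_def sds_map_def flip: P_def)
    then have "restrict (sds_map F (i # \<omega>)) P =
        compose P (restrict (sds_map F \<omega>) P) (Fstar n F i)"
      by (rule ext)
    also have "\<dots> = restrict (sds_map F \<omega>) P \<otimes>\<^bsub>B\<^esub> Fstar n F i"
      by (rule B_mult[OF rest Fs[OF i], symmetric])
    finally show ?case using generate.eng[OF IH FT[OF i]] by (simp only:)
  qed
  then have S1: "S \<subseteq> generate B T" by (auto simp: S_def update_order_def)
  have "T \<subseteq> S"
  proof
    fix x assume "x \<in> T"
    then obtain i where "i \<in> {1..n}" "x = restrict (sds_map F [i]) P"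
      by (auto simp: T_def Fstar_def sds_map_def P_def)
    then show "x \<in> S" unfolding S_def update_order_def
      by (intro CollectI exI[of _ "[i]"]) auto
  qed
  then have "generate B T \<subseteq> generate B S" by (rule B.mono_generate)
  moreover have "generate B S \<subseteq> generate B T"
    by (rule B.generate_subgroup_incl[OF S1 sub])
  ultimately show ?thesis by (auto simp: DG_def B_def T_def S_def P_def)
qed

theorem theorem3p7:
  fixes n :: nat and Y :: "nat pair_pre_digraph" and F :: "nat \<Rightarrow> state \<Rightarrow> state"
  assumes "pair_graph Y" and "pverts Y = {1..n}"
    and "\<forall>i\<in>{1..n}. local_at Y n i (F i)"
    and "pi_independent n F"
  shows "(\<forall>i\<in>{1..n}. Fstar n F i = \<one>\<^bsub>BijGroup (Per n F)\<^esub> \<or>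
                     involution (BijGroup (Per n F)) (Fstar n F i)) \<and>
         (trivial_group (DG n F) \<or> quotient_of_coxeter_group (DG n F))"
proof
  let ?P = "Per n F"
  let ?B = "BijGroup ?P"
  let ?T = "Fstar n F ` {1..n} - {\<one>\<^bsub>?B\<^esub>}"
  have "F i \<in> states n \<rightarrow> states n" if "i \<in> {1..n}" for i
    using assms(3) that by (auto simp: local_at_def)
  then have bij: "bij_betw (F i) ?P ?P" if "i \<in> {1..n}" for i
    using bij_betw_Per[of n F i] assms(4) that by blast
  have P: "?P \<subseteq> states n" by (auto simp: Per_def periodic_states_def)
  have carr: "Fstar n F i \<in> carrier ?B" if "i \<in> {1..n}" for i
    using bij[OF that] by (simp add: Fstar_def BijGroup_def Bij_def)
  have sq: "Fstar n F i \<otimes>\<^bsub>?B\<^esub> Fstar n F i = \<one>\<^bsub>?B\<^esub>" if i: "i \<in> {1..n}" for i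
  proof -
    have "F i (F i y) = y" if "y \<in> ?P" for y
      using local_at_involutive[OF _ bij[OF i] P that] assms(3) i by blast
    moreover have "F i y \<in> ?P" if "y \<in> ?P" for y
      using bij[OF i] that by (auto simp: bij_betw_def)
    ultimately show ?thesis
      using carr[OF i] by (auto simp: BijGroup_def compose_def Fstar_def fun_eq_iff)
  qed
  show first: "\<forall>i\<in>{1..n}. Fstar n F i = \<one>\<^bsub>?B\<^esub> \<or> involution ?B (Fstar n F i)"
    using carr sq by (auto simp: involution_def)
  interpret B: group ?B by (rule group_BijGroup)
  have TB: "?T \<subseteq> carrier ?B" using carr by auto
  have car: "carrier (DG n F) = generate ?B ?T" using DG_eq_generate bij by blast
  have DG: "DG n F = ?B\<lparr>carrier := generate ?B ?T\<rparr>"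
    using car by (simp add: DG_def)
  have sub: "subgroup (generate ?B ?T) ?B" by (rule B.generate_is_subgroup[OF TB])
  have T: "?T \<subseteq> generate ?B ?T" by (auto intro: generate.incl)
  interpret DG: group "DG n F"
    unfolding DG by (rule B.subgroup_imp_group[OF sub])
  have "quotient_of_coxeter_group (DG n F)"
  proof (rule DG.quotient_of_coxeter_group_if_generated_by_involutions[of ?T])
    show "generate (DG n F) ?T = carrier (DG n F)"
      using B.generate_consistent[OF T sub] by (simp add: DG)
    show "involution (DG n F) t" if "t \<in> ?T" for t
      using that first T by (auto simp: involution_def DG)
  qed simp
  then show "trivial_group (DG n F) \<or> quotient_of_coxeter_group (DG n F)" ..
qed

end
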